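(* For all integers $1 \le k \le n$, \[\sum_{i=0}^{k}\binom{n}{i} \le \frac{k^{\hat p}-1}{k-1} + 2^n\left(1-2^{-k}\right)^{\hat p},\qquad\text{where } \hat p = \left\lfloor \frac{n-k}{\log_2\!\big(k/(1-2^{-k})\big)}\right\rfloor + 1,\] and where the quantity $\frac{k^{p}-1}{k-1}$ is understood as $\sum_{j=0}^{p-1}k^j$ (so it equals $p$ when $k=1$). *)

theory Defs
  imports Complex_Main
begin

text \<open>For \<open>1 \<le> k \<le> n\<close> the numerator is nonnegative and the logarithm is positive, so the floor is
  a nonnegative integer and \<open>nat\<close> does not truncate.\<close>

definition p_hat :: "nat \<Rightarrow> nat \<Rightarrow> nat" where
  "p_hat n k = nat \<lfloor>(real n - real k) / log 2 (real k / (1 - 1 / 2 ^ k))\<rfloor> + 1"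

end

theory Submission
  imports Defs
begin

text \<open>
  Write \<open>S n m\<close> for the number of binary words of length \<open>n\<close> and weight at most \<open>m\<close>. Such a word
  either starts with \<open>m\<close> ones, and is then determined, or has its first zero at a position
  \<open>i \<le> m\<close>. For \<open>m = k \<le> n\<close> this gives \<open>S n k \<le> 1 + (\<Sum>i=1..k. S (n - i) k)\<close>. Iterating this
  \<open>p\<close> times, starting from \<open>S n k \<le> 2 ^ n\<close> and using \<open>(\<Sum>i=1..k. 2 ^ (n - i)) = 2 ^ n * (1 - 1 / 2 ^ k)\<close>,
  yields the bound for every \<open>p\<close>. The number \<open>p_hat n k\<close> is the choice of \<open>p\<close> that minimises it.
\<close>

text \<open>Pascal's rule, summed: the words are split by first letter, zero or one.\<close>

lemma sum_choose_Suc_Suc: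
  "(\<Sum>i\<le>Suc m. Suc n choose i) = (\<Sum>i\<le>Suc m. n choose i) + (\<Sum>i\<le>m. n choose i)"
proof -
  have "(\<Sum>i\<le>Suc m. Suc n choose i) = 1 + (\<Sum>i\<le>m. n choose i) + (\<Sum>i\<le>m. n choose Suc i)"
    by (subst sum.atMost_Suc_shift) (simp add: sum.distrib)
  also have "\<dots> = (\<Sum>i\<le>Suc m. n choose i) + (\<Sum>i\<le>m. n choose i)"
    by (subst sum.atMost_Suc_shift) simp
  finally show ?thesis .
qed

lemma sum_choose_le_two_power: "(\<Sum>i\<le>m. n choose i) \<le> 2 ^ n"
proof -
  have "(\<Sum>i\<le>m. n choose i) \<le> (\<Sum>i\<le>m + n. n choose i)"
    by (rule sum_mono2) auto
  also have "\<dots> = (\<Sum>i\<le>n. n choose i)"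
    by (rule sum.mono_neutral_right) auto
  finally show ?thesis
    by (simp add: choose_row_sum)
qed

text \<open>Induction on \<open>m\<close> strips the first letter: a zero gives the term
  \<open>j = 0\<close>, a one lowers \<open>n\<close> and \<open>m\<close> together. Keeping
  \<open>k\<close> apart from \<open>m\<close> leaves the weight bound fixed meanwhile.\<close>

lemma sum_choose_le_first_zero:
  assumes "m \<le> k" "m \<le> n"
  shows "(\<Sum>i\<le>m. n choose i) \<le> 1 + (\<Sum>j<m. \<Sum>i\<le>k. (n - Suc j) choose i)"
  using assms
proof (induction m arbitrary: n)
  case 0
  then show ?case by simp
next
  case (Suc m)
  then obtain n' where n: "n = Suc n'"
    by (cases n) auto
  have "(\<Sum>i\<le>Suc m. n' choose i) \<le> (\<Sum>i\<le>k. n' choose i)"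
    using Suc.prems by (intro sum_mono2) auto
  moreover have "(\<Sum>i\<le>m. n' choose i) \<le> 1 + (\<Sum>j<m. \<Sum>i\<le>k. (n' - Suc j) choose i)"
    using Suc n by simp
  ultimately show ?case
    unfolding n sum_choose_Suc_Suc by (subst sum.lessThan_Suc_shift) simp
qed

lemma sum_two_power_diff:
  assumes "k \<le> n"
  shows "(\<Sum>j<k. 2 ^ (n - Suc j)) = 2 ^ n * (1 - 1 / 2 ^ k :: real)"
  using assms
proof (induction k)
  case 0
  then show ?case by simp
next
  case (Suc k)
  then have "(2::real) ^ (n - Suc k) = 2 ^ n / 2 ^ Suc k"
    by (intro power_diff) auto
  with Suc show ?case
    by (simp add: field_simps)
qed

text \<open>Lengths \<open>n < k\<close> are included because the recursion passes to
  \<open>n - Suc j\<close>, which can drop below \<open>k\<close>.\<close>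

lemma sum_choose_le_geometric:
  fixes n k p :: nat
  assumes "1 \<le> k"
  shows "(\<Sum>i\<le>k. real (n choose i)) \<le> (\<Sum>j<p. real k ^ j) + 2 ^ n * (1 - 1 / 2 ^ k) ^ p"
proof (induction p arbitrary: n)
  case 0
  have "real (\<Sum>i\<le>k. n choose i) \<le> real (2 ^ n)"
    by (simp only: of_nat_le_iff sum_choose_le_two_power)
  then show ?case by simp
next
  case (Suc p)
  define c :: real where "c = 1 - 1 / 2 ^ k"
  have c: "0 \<le> c" "c \<le> 1"
    by (auto simp: c_def)
  show ?case
  proof (cases "k \<le> n")
    case True
    have "real (\<Sum>i\<le>k. n choose i) \<le> real (1 + (\<Sum>j<k. \<Sum>i\<le>k. (n - Suc j) choose i))"
      using sum_choose_le_first_zero[of k k n] True by (simp only: of_nat_le_iff)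
    then have "(\<Sum>i\<le>k. real (n choose i)) \<le> 1 + (\<Sum>j<k. \<Sum>i\<le>k. real ((n - Suc j) choose i))"
      by simp
    also have "\<dots> \<le> 1 + (\<Sum>j<k. (\<Sum>l<p. real k ^ l) + 2 ^ (n - Suc j) * c ^ p)"
      unfolding c_def by (intro add_left_mono sum_mono Suc.IH)
    also have "\<dots> = 1 + real k * (\<Sum>l<p. real k ^ l) + (\<Sum>j<k. 2 ^ (n - Suc j)) * c ^ p"
      by (simp add: sum.distrib sum_distrib_right)
    also have "\<dots> = (\<Sum>l<Suc p. real k ^ l) + 2 ^ n * c ^ Suc p"
      by (subst sum.lessThan_Suc_shift)
        (simp add: sum_distrib_left sum_two_power_diff[OF True] c_def)
    finally show ?thesis
      unfolding c_def .
  next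
    case False
    txt \<open>Here raising \<open>p\<close> adds \<open>k ^ p \<ge> 1\<close> to the bound and removes at most \<open>2 ^ n / 2 ^ k \<le> 1\<close>.\<close>
    have "2 ^ n * c ^ p * (1 / 2 ^ k) \<le> 2 ^ k * 1 * (1 / 2 ^ k)"
      using False c by (intro mult_mono power_increasing power_le_one) auto
    then have "2 ^ n * c ^ p * (1 / 2 ^ k) \<le> 1"
      by simp
    moreover have "1 \<le> real k ^ p"
      using assms by simp
    moreover have "2 ^ n * c ^ Suc p = 2 ^ n * c ^ p - 2 ^ n * c ^ p * (1 / 2 ^ k)"
      by (simp add: c_def algebra_simps)
    ultimately show ?thesis
      using Suc.IH[of n] unfolding c_def[symmetric] sum.lessThan_Suc by linarith
  qed
qed

theorem theorem2:
  fixes n k :: nat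
  assumes "1 \<le> k" and "k \<le> n"
  shows "(\<Sum>i=0..k. real (n choose i))
           \<le> (\<Sum>j<p_hat n k. real k ^ j) + 2 ^ n * (1 - 1 / 2 ^ k) ^ p_hat n k"
  using sum_choose_le_geometric[OF assms(1)] by (simp add: atLeast0AtMost)

end
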